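(* Every graph with boolean-width $k$ has twin-width at most $2^{k+1}-1$.
   Context: Graphs are finite, simple, undirected. The boolean-width of a partition $(A,B)$ of $V(G)$ is the base-2 logarithm of the number of distinct sets $N(S)\cap B$ for $S\subseteq A$. A decomposition tree of $G$ is a tree in which every internal node has exactly two children, whose leaves are in bijection with $V(G)$; each edge $e$ of the tree yields the partition $(A_e,B_e)$ of $V(G)$ given by the leaves of the two components of the tree minus $e$. The boolean-width of a decomposition tree is the maximum boolean-width of $(A_e,B_e)$ over its edges, and the boolean-width of $G$ is the minimum over all decomposition trees. Twin-width: a trigraph is $(V,E,R)$ with disjoint black edge set $E$ and red edge set $R$; a graph $(V,E)$ is the trigraph $(V,E,\emptyset)$. Contracting distinct vertices $u,v$ replaces them by $w$, keeps the rest, and for each other vertex $x$: $wx$ black iff $ux,vx$ both black; $wx$ absent iff neither $ux$ nor $vx$ is black or red; $wx$ red otherwise. The twin-width of an $n$-vertex graph $G$ is the least $d$ such that some sequence $G=G_n,\ldots,G_1$ of single contractions ending in one vertex has all $G_i$ of maximum red degree at most $d$. *)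

theory Defs
  imports Complex_Main "Graph_Theory.Pair_Digraph"
begin

text \<open>
  A finite simple undirected graph is a \<^locale>\<open>pair_graph\<close>: each undirected edge is
  represented by its two opposite arcs.
\<close>

section \<open>Boolean-width\<close>

definition nbhd :: "'a pair_pre_digraph \<Rightarrow> 'a set \<Rightarrow> 'a set" where
  "nbhd G S = {y. \<exists>x\<in>S. (x, y) \<in> parcs G}"

definition cut_boolean_width :: "'a pair_pre_digraph \<Rightarrow> 'a set \<Rightarrow> 'a set \<Rightarrow> real" where
  "cut_boolean_width G A B = log 2 (real (card {nbhd G S \<inter> B |S. S \<subseteq> A}))"

datatype 'a dtree = DLeaf 'a | DNode "'a dtree" "'a dtree"

primrec leaves :: "'a dtree \<Rightarrow> 'a list" where
  "leaves (DLeaf v) = [v]"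
| "leaves (DNode l r) = leaves l @ leaves r"

definition decomposition_tree :: "'a pair_pre_digraph \<Rightarrow> 'a dtree \<Rightarrow> bool" where
  "decomposition_tree G T \<longleftrightarrow> distinct (leaves T) \<and> set (leaves T) = pverts G"

text \<open>
  Every edge of the tree joins a node \<open>t\<close> other than the root to its parent. Removing it leaves
  the subtree rooted at \<open>t\<close> as one of the two components; these are the leaf sets of those
  components.
\<close>

primrec lower_sides :: "'a dtree \<Rightarrow> 'a set set" where
  "lower_sides (DLeaf v) = {}"
| "lower_sides (DNode l r) =
     {set (leaves l), set (leaves r)} \<union> lower_sides l \<union> lower_sides r"

text \<open>
  The partition of an edge is taken as \<open>(A, V - A)\<close> with \<open>A\<close> on the side away from the root.
  The order of the two sides is immaterial, since the number of distinct sets \<open>N(S) \<inter> B\<close> with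
  \<open>S \<subseteq> A\<close> equals the number of distinct sets \<open>N(S) \<inter> A\<close> with \<open>S \<subseteq> B\<close>.
  Inserting \<open>0\<close> matters only for a single-leaf tree, which has no edges: the boolean-width of a
  cut is never negative, because \<open>S = {}\<close> always contributes a set.
\<close>

definition tree_boolean_width :: "'a pair_pre_digraph \<Rightarrow> 'a dtree \<Rightarrow> real" where
  "tree_boolean_width G T =
     Max (insert 0 {cut_boolean_width G A (pverts G - A) |A. A \<in> lower_sides T})"

text \<open>
  For a nonempty finite vertex set the minimum is over a finite nonempty set; a graph without
  vertices has no decomposition tree.
\<close>

definition boolean_width :: "'a pair_pre_digraph \<Rightarrow> real" where
  "boolean_width G = Min {tree_boolean_width G T |T. decomposition_tree G T}"

section \<open>Twin-width\<close>

text \<open>As for graphs, both edge sets of a trigraph are symmetric relations.\<close>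

record 'a trigraph =
  tverts :: "'a set"
  black :: "('a \<times> 'a) set"
  red :: "('a \<times> 'a) set"

definition trigraph_of :: "'a pair_pre_digraph \<Rightarrow> 'a trigraph" where
  "trigraph_of G = \<lparr>tverts = pverts G, black = parcs G, red = {}\<rparr>"

definition contract :: "'a \<Rightarrow> 'a \<Rightarrow> 'a \<Rightarrow> 'a trigraph \<Rightarrow> 'a trigraph" where
  "contract u v w H =
     (let X = tverts H - {u, v};
          Bl = {x \<in> X. (u, x) \<in> black H \<and> (v, x) \<in> black H};
          Ab = {x \<in> X. (u, x) \<notin> black H \<union> red H \<and> (v, x) \<notin> black H \<union> red H};
          Rd = X - Bl - Ab
      in \<lparr>tverts = insert w X,
          black = black H \<inter> X \<times> X \<union> {w} \<times> Bl \<union> Bl \<times> {w},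
          red = red H \<inter> X \<times> X \<union> {w} \<times> Rd \<union> Rd \<times> {w}\<rparr>)"

text \<open>
  The name of the new vertex is irrelevant as long as it differs from all the vertices that are
  kept. Reusing \<open>u\<close> or \<open>v\<close> is allowed, so contractions are possible even when no fresh element
  of the vertex type is left.
\<close>

definition contraction :: "'a trigraph \<Rightarrow> 'a trigraph \<Rightarrow> bool" where
  "contraction H H' \<longleftrightarrow>
     (\<exists>u v w. u \<in> tverts H \<and> v \<in> tverts H \<and> u \<noteq> v \<and> w \<notin> tverts H - {u, v} \<and>
        H' = contract u v w H)"

definition max_red_degree :: "'a trigraph \<Rightarrow> nat" where
  "max_red_degree H = Max {card {y. (x, y) \<in> red H} |x. x \<in> tverts H}"

definition contraction_sequence :: "'a pair_pre_digraph \<Rightarrow> (nat \<Rightarrow> 'a trigraph) \<Rightarrow> bool" where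
  "contraction_sequence G H \<longleftrightarrow>
     H (card (pverts G)) = trigraph_of G \<and>
     (\<forall>i\<in>{1..<card (pverts G)}. contraction (H (Suc i)) (H i)) \<and>
     card (tverts (H 1)) = 1"

definition twin_width :: "'a pair_pre_digraph \<Rightarrow> nat" where
  "twin_width G =
     (LEAST d. \<exists>H. contraction_sequence G H \<and>
        (\<forall>i\<in>{1..card (pverts G)}. max_red_degree (H i) \<le> d))"

end

theory Submission
  imports Defs "HOL-Library.Disjoint_Sets"
begin

text \<open>
  Process the decomposition tree bottom-up. Once a subtree with leaf set \<open>A\<close> has been processed,
  \<open>A\<close> is contracted to its classes of vertices with equal neighbourhood outside \<open>A\<close>; singletons
  \<open>S\<close> in the definition of boolean-width show that there are at most \<open>2\<^sup>k\<close> of them. At any time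
  the vertex set is partitioned into blocks such that contracted vertices share a block and agree
  outside it. Two parts in different blocks are then homogeneous to each other, so red edges stay
  inside blocks. The block of an inner node arises from the at most \<open>2 \<cdot> 2\<^sup>k\<close> parts of its two
  children, hence red degrees never exceed \<open>2 \<cdot> 2\<^sup>k - 1\<close>.
\<close>

section \<open>Quotient trigraphs\<close>

definition all_adj :: "'a pair_pre_digraph \<Rightarrow> ('a \<Rightarrow> 'a) \<Rightarrow> 'a \<Rightarrow> 'a \<Rightarrow> bool" where
  "all_adj G f p q \<longleftrightarrow>
     (\<forall>x\<in>pverts G. \<forall>y\<in>pverts G. f x = p \<longrightarrow> f y = q \<longrightarrow> (x, y) \<in> parcs G)"

definition any_adj :: "'a pair_pre_digraph \<Rightarrow> ('a \<Rightarrow> 'a) \<Rightarrow> 'a \<Rightarrow> 'a \<Rightarrow> bool" where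
  "any_adj G f p q \<longleftrightarrow>
     (\<exists>x\<in>pverts G. \<exists>y\<in>pverts G. f x = p \<and> f y = q \<and> (x, y) \<in> parcs G)"

text \<open>The fibres of \<open>f\<close> are the sets of original vertices merged so far, named by
  their common value. Encoding the partition as a function makes a contraction a renaming of one
  value, and the trigraph depends on \<open>f\<close> alone, not on the order of
  contractions.\<close>

definition quotient_trigraph :: "'a pair_pre_digraph \<Rightarrow> ('a \<Rightarrow> 'a) \<Rightarrow> 'a trigraph" where
  "quotient_trigraph G f =
     (let P = f ` pverts G in
      \<lparr>tverts = P,
       black = {(p, q). p \<in> P \<and> q \<in> P \<and> p \<noteq> q \<and> all_adj G f p q},
       red = {(p, q). p \<in> P \<and> q \<in> P \<and> p \<noteq> q \<and> any_adj G f p q \<and> \<not> all_adj G f p q}\<rparr>)"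

lemma tverts_quotient [simp]: "tverts (quotient_trigraph G f) = f ` pverts G"
  by (simp add: quotient_trigraph_def Let_def)

lemma any_adj_if_all_adj:
  assumes "p \<in> f ` pverts G" "q \<in> f ` pverts G" "all_adj G f p q"
  shows "any_adj G f p q"
  using assms unfolding all_adj_def any_adj_def by auto

lemma (in pair_graph) all_adj_commute: "all_adj G f p q \<longleftrightarrow> all_adj G f q p"
  unfolding all_adj_def by (meson arcs_symmetric)

lemma (in pair_graph) any_adj_commute: "any_adj G f p q \<longleftrightarrow> any_adj G f q p"
  unfolding any_adj_def by (meson arcs_symmetric)

text \<open>The starting trigraph: fibres of \<open>id\<close> are singletons, so no pair is mixed,
  and since there are no loops the condition \<open>p \<noteq> q\<close> discards no arc.\<close>

lemma (in pair_graph) quotient_trigraph_id: "quotient_trigraph G id = trigraph_of G"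
proof -
  have arc: "a \<in> pverts G \<and> b \<in> pverts G \<and> a \<noteq> b" if "(a, b) \<in> parcs G" for a b
    using that in_arcsD1 in_arcsD2 no_loops' by blast
  have adj: "all_adj G id p q \<longleftrightarrow> (p, q) \<in> parcs G" "any_adj G id p q \<longleftrightarrow> (p, q) \<in> parcs G"
    if "p \<in> pverts G" "q \<in> pverts G" for p q
    using that by (simp_all add: all_adj_def any_adj_def)
  have "{(p, q). p \<in> pverts G \<and> q \<in> pverts G \<and> p \<noteq> q \<and> all_adj G id p q} = parcs G"
    using arc adj by blast
  moreover have
    "{(p, q). p \<in> pverts G \<and> q \<in> pverts G \<and> p \<noteq> q \<and> any_adj G id p q \<and> \<not> all_adj G id p q} = {}"
    using adj by blast
  ultimately show ?thesis
    by (simp add: quotient_trigraph_def trigraph_of_def Let_def)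
qed

text \<open>The fibre of \<open>p\<close> under \<open>g\<close> is the union of the fibres of
  \<open>p\<close> and \<open>q\<close> under \<open>f\<close>. Over this union
  \<open>all_adj\<close> becomes a conjunction and \<open>any_adj\<close> a disjunction, which are
  the rules of \<open>contract\<close> for black and for present edges. Reusing the name
  \<open>p\<close> avoids a fresh vertex.\<close>

lemma (in pair_graph) contract_quotient:
  fixes p q :: 'a and f :: "'a \<Rightarrow> 'a"
  defines "g \<equiv> (\<lambda>x. if f x = q then p else f x)"
  assumes p: "p \<in> f ` pverts G" and q: "q \<in> f ` pverts G" and "p \<noteq> q"
  shows "contract p q p (quotient_trigraph G f) = quotient_trigraph G g"
proof -
  define P where "P = f ` pverts G"
  have img: "g ` pverts G = insert p (P - {p, q})"
    using p \<open>p \<noteq> q\<close> by (force simp: g_def P_def)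
  have gp: "g z = p \<longleftrightarrow> f z = p \<or> f z = q"
    and gr: "r \<noteq> p \<Longrightarrow> r \<noteq> q \<Longrightarrow> g z = r \<longleftrightarrow> f z = r" for r z
    by (auto simp: g_def)
  have all1: "all_adj G g p r \<longleftrightarrow> all_adj G f p r \<and> all_adj G f q r"
    and any1: "any_adj G g p r \<longleftrightarrow> any_adj G f p r \<or> any_adj G f q r"
    if "r \<noteq> p" "r \<noteq> q" for r
    using that unfolding all_adj_def any_adj_def by (simp_all add: gp gr) blast+
  have all2: "all_adj G g r p \<longleftrightarrow> all_adj G f p r \<and> all_adj G f q r"
    and any2: "any_adj G g r p \<longleftrightarrow> any_adj G f p r \<or> any_adj G f q r"
    if "r \<noteq> p" "r \<noteq> q" for r
    using all1[OF that] any1[OF that] all_adj_commute[of g r p] any_adj_commute[of g r p] by simp_all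
  have all3: "all_adj G g r s \<longleftrightarrow> all_adj G f r s"
    and any3: "any_adj G g r s \<longleftrightarrow> any_adj G f r s"
    if "r \<noteq> p" "r \<noteq> q" "s \<noteq> p" "s \<noteq> q" for r s
    using that unfolding all_adj_def any_adj_def by (simp_all add: gr)
  have any_all: "any_adj G f r s" if "all_adj G f r s" "r \<in> P" "s \<in> P" for r s
    using that any_adj_if_all_adj unfolding P_def by metis
  have pq: "p \<in> P" "q \<in> P"
    using p q by (simp_all add: P_def)
  define X where "X = P - {p, q}"
  have X: "r \<in> P" "r \<noteq> p" "r \<noteq> q" if "r \<in> X" for r
    using that by (auto simp: X_def)
  define Q where "Q = quotient_trigraph G f"
  have black_Q: "(a, b) \<in> black Q \<longleftrightarrow> a \<in> P \<and> b \<in> P \<and> a \<noteq> b \<and> all_adj G f a b"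
    and red_Q: "(a, b) \<in> red Q \<longleftrightarrow>
      a \<in> P \<and> b \<in> P \<and> a \<noteq> b \<and> any_adj G f a b \<and> \<not> all_adj G f a b" for a b
    by (auto simp: Q_def quotient_trigraph_def Let_def P_def)
  have vQ: "tverts Q = P" by (simp add: Q_def P_def)
  define R where "R = quotient_trigraph G g"
  have black_R: "(a, b) \<in> black R \<longleftrightarrow>
      a \<in> insert p X \<and> b \<in> insert p X \<and> a \<noteq> b \<and> all_adj G g a b"
    and red_R: "(a, b) \<in> red R \<longleftrightarrow>
      a \<in> insert p X \<and> b \<in> insert p X \<and> a \<noteq> b \<and> any_adj G g a b \<and> \<not> all_adj G g a b" for a b
    by (auto simp: R_def quotient_trigraph_def Let_def img X_def)
  have vR: "tverts R = insert p X" by (simp add: R_def img X_def)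
  \<comment> \<open>These copy the local sets of \<open>contract\<close>, so that its unfolded form
    folds back into them at the end.\<close>
  define Bl where "Bl = {x \<in> X. (p, x) \<in> black Q \<and> (q, x) \<in> black Q}"
  define Ab where "Ab = {x \<in> X. (p, x) \<notin> black Q \<union> red Q \<and> (q, x) \<notin> black Q \<union> red Q}"
  have Bl: "r \<in> Bl \<longleftrightarrow> r \<in> X \<and> all_adj G g p r" for r
    using X pq all1 by (auto simp: Bl_def black_Q)
  \<comment> \<open>Black or red together amount to \<open>any_adj\<close>, since black implies
    \<open>any_adj\<close> between nonempty fibres.\<close>
  have Ab: "r \<in> Ab \<longleftrightarrow> r \<in> X \<and> \<not> any_adj G g p r" for r
    using X pq any1 any_all by (auto simp: Ab_def black_Q red_Q)
  have bl: "black Q \<inter> X \<times> X \<union> {p} \<times> Bl \<union> Bl \<times> {p} = black R"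
  proof (intro set_eqI, clarify)
    fix a b
    show "(a, b) \<in> black Q \<inter> X \<times> X \<union> {p} \<times> Bl \<union> Bl \<times> {p} \<longleftrightarrow> (a, b) \<in> black R"
      using X all3 all_adj_commute[of g] by (auto simp: black_Q black_R Bl)
  qed
  have rd: "red Q \<inter> X \<times> X \<union> {p} \<times> (X - Bl - Ab) \<union> (X - Bl - Ab) \<times> {p} = red R"
  proof (intro set_eqI, clarify)
    fix a b
    show "(a, b) \<in> red Q \<inter> X \<times> X \<union> {p} \<times> (X - Bl - Ab) \<union> (X - Bl - Ab) \<times> {p} \<longleftrightarrow> (a, b) \<in> red R"
      using X all3 any3 all_adj_commute[of g] any_adj_commute[of g]
      by (auto simp: red_Q red_R Bl Ab)
  qed
  have "contract p q p Q = R"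
    unfolding contract_def Let_def vQ X_def[symmetric] Bl_def[symmetric] Ab_def[symmetric] bl rd
    using vR by simp
  then show ?thesis by (simp add: Q_def R_def)
qed

section \<open>Block systems\<close>

definition outside_nbhd :: "'a pair_pre_digraph \<Rightarrow> 'a set \<Rightarrow> 'a \<Rightarrow> 'a set" where
  "outside_nbhd G A x = nbhd G {x} \<inter> (pverts G - A)"

lemma mem_outside_nbhd:
  "z \<in> outside_nbhd G A x \<longleftrightarrow> z \<in> pverts G \<and> z \<notin> A \<and> (x, z) \<in> parcs G"
  by (auto simp: outside_nbhd_def nbhd_def)

definition block :: "'a pair_pre_digraph \<Rightarrow> ('a \<Rightarrow> 'a) \<Rightarrow> 'a set \<Rightarrow> bool" where
  "block G f B \<longleftrightarrow>
     (\<forall>x\<in>B. \<forall>y\<in>pverts G. f x = f y \<longrightarrow> y \<in> B \<and> outside_nbhd G B x = outside_nbhd G B y)"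

lemma blockD:
  assumes "block G f B" "x \<in> B" "y \<in> pverts G" "f y = f x"
  shows "y \<in> B" "outside_nbhd G B y = outside_nbhd G B x"
  using assms unfolding block_def by metis+

text \<open>The bound \<open>m\<close> is imposed on every block, not only on the one being
  contracted, because red degrees have to be controlled everywhere.\<close>

definition block_system :: "'a pair_pre_digraph \<Rightarrow> nat \<Rightarrow> ('a \<Rightarrow> 'a) \<Rightarrow> 'a set set \<Rightarrow> bool" where
  "block_system G m f D \<longleftrightarrow>
     partition_on (pverts G) D \<and> (\<forall>B\<in>D. block G f B \<and> card (f ` B) \<le> m)"

text \<open>No red edge leaves a block, since fibres in different blocks are either completely
  adjacent or not adjacent at all. A part thus has red neighbours only among the other parts of its
  block, which gives \<open>m - 1\<close> instead of \<open>m\<close>.\<close>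

lemma (in pair_graph) max_red_degree_block_system:
  assumes sys: "block_system G m f D" and "pverts G \<noteq> {}"
  shows "max_red_degree (quotient_trigraph G f) \<le> m - 1"
proof -
  let ?H = "quotient_trigraph G f"
  have deg: "card {q. (p, q) \<in> red ?H} \<le> m - 1" if p: "p \<in> f ` pverts G" for p
  proof -
    obtain x where x: "x \<in> pverts G" "p = f x" using p by blast
    obtain B where B: "B \<in> D" "x \<in> B"
      using sys x unfolding block_system_def partition_on_def by auto
    have BV: "B \<subseteq> pverts G" and bB: "block G f B" and cB: "card (f ` B) \<le> m"
      using sys B unfolding block_system_def partition_on_def by auto
    have "{q. (p, q) \<in> red ?H} \<subseteq> f ` B - {p}"
    proof
      fix q assume "q \<in> {q. (p, q) \<in> red ?H}"
      then have "p \<noteq> q" "any_adj G f p q" "\<not> all_adj G f p q"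
        by (auto simp: quotient_trigraph_def Let_def)
      then obtain x1 y1 x2 y2 where
        V: "x1 \<in> pverts G" "y1 \<in> pverts G" "x2 \<in> pverts G" "y2 \<in> pverts G"
        and f: "f x1 = p" "f y1 = q" "f x2 = p" "f y2 = q"
        and E: "(x1, y1) \<in> parcs G" "(x2, y2) \<notin> parcs G"
        unfolding any_adj_def all_adj_def by blast
      have x12: "x1 \<in> B" "x2 \<in> B" "outside_nbhd G B x1 = outside_nbhd G B x2"
        using bB B x V f unfolding block_def by metis+
      \<comment> \<open>Otherwise the arc \<open>(x1, y1)\<close> moves to \<open>(x2, y1)\<close>,
        as \<open>x1\<close> and \<open>x2\<close> agree outside \<open>B\<close>, and then to
        \<open>(x2, y2)\<close>, as \<open>y1\<close> and \<open>y2\<close> agree outside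
        \<open>B'\<close>; but the latter is no arc.\<close>
      have "y1 \<in> B"
      proof (rule ccontr)
        assume y1: "y1 \<notin> B"
        obtain B' where B': "B' \<in> D" "y1 \<in> B'"
          using sys V unfolding block_system_def partition_on_def by auto
        have "B \<inter> B' = {}"
          using sys B B' y1 unfolding block_system_def partition_on_def disjoint_def by blast
        then have "x2 \<notin> B'" using x12 by auto
        have "block G f B'" using sys B' unfolding block_system_def by auto
        then have "outside_nbhd G B' y1 = outside_nbhd G B' y2"
          using B' V f unfolding block_def by metis
        moreover have "(x2, y1) \<in> parcs G"
          using E(1) V y1 x12 mem_outside_nbhd by metis
        ultimately show False
          using E(2) V \<open>x2 \<notin> B'\<close> mem_outside_nbhd arcs_symmetric by metis
      qed
      then show "q \<in> f ` B - {p}" using f \<open>p \<noteq> q\<close> by auto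
    qed
    moreover have fin: "finite (f ` B)"
      using BV finite_verts finite_subset by blast
    ultimately have "card {q. (p, q) \<in> red ?H} \<le> card (f ` B - {p})"
      by (simp add: card_mono)
    also have "\<dots> \<le> m - 1"
      using B x fin cB by simp
    finally show ?thesis .
  qed
  have "{card {y. (x, y) \<in> red ?H} |x. x \<in> tverts ?H} =
      (\<lambda>x. card {y. (x, y) \<in> red ?H}) ` (f ` pverts G)"
    by auto
  then show ?thesis
    unfolding max_red_degree_def using deg assms(2) finite_verts by simp
qed

section \<open>Contracting blocks along a decomposition tree\<close>

definition bounded_contraction :: "nat \<Rightarrow> 'a trigraph \<Rightarrow> 'a trigraph \<Rightarrow> bool" where
  "bounded_contraction d H H' \<longleftrightarrow> contraction H H' \<and> max_red_degree H' \<le> d"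

text \<open>Pigeonhole: while \<open>A\<close> has more parts than outside neighbourhoods, two parts
  share one, and merging them keeps \<open>A\<close> a block and lowers its number of parts. The
  values on the other blocks never change.\<close>

lemma (in pair_graph) contract_block:
  assumes "block_system G m f (insert A D)" and "A \<notin> D"
  shows "\<exists>g. (bounded_contraction (m - 1))\<^sup>*\<^sup>* (quotient_trigraph G f) (quotient_trigraph G g) \<and>
    block_system G m g (insert A D) \<and> (\<forall>x\<in>\<Union>D. g x = f x) \<and>
    card (g ` A) \<le> card (outside_nbhd G A ` A)"
  using assms(1)
proof (induction "card (f ` A)" arbitrary: f rule: less_induct)
  case less
  have part: "partition_on (pverts G) (insert A D)"
    and blocks: "\<And>B. B \<in> insert A D \<Longrightarrow> block G f B \<and> card (f ` B) \<le> m"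
    using less.prems unfolding block_system_def by auto
  have AV: "A \<subseteq> pverts G" "A \<noteq> {}" using part by (auto simp: partition_on_def)
  have finA: "finite A" using AV finite_verts finite_subset by blast
  show ?case
  proof (cases "card (f ` A) \<le> card (outside_nbhd G A ` A)")
    case True
    then show ?thesis using less.prems by blast
  next
    case False
    define r where "r = inv_into A f"
    have r: "r p \<in> A" "f (r p) = p" if "p \<in> f ` A" for p
      using that by (simp_all add: r_def inv_into_into f_inv_into_f)
    have "\<not> inj_on (\<lambda>p. outside_nbhd G A (r p)) (f ` A)"
    proof
      assume "inj_on (\<lambda>p. outside_nbhd G A (r p)) (f ` A)"
      then have "card (f ` A) \<le> card (outside_nbhd G A ` A)"
        using r finA by (intro card_inj_on_le[of "\<lambda>p. outside_nbhd G A (r p)"]) blast+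
      then show False using False by simp
    qed
    then obtain x y where xy: "x \<in> A" "y \<in> A" "f x \<noteq> f y"
      "outside_nbhd G A x = outside_nbhd G A y"
      unfolding inj_on_def using r by metis
    define g where "g = (\<lambda>z. if f z = f y then f x else f z)"
    have V: "x \<in> pverts G" "y \<in> pverts G" using xy AV by auto
    \<comment> \<open>The fibres of \<open>f x\<close> and \<open>f y\<close> lie within the block
      \<open>A\<close>, so renaming \<open>f y\<close> affects no vertex outside
      \<open>A\<close>.\<close>
    have sep: "f z \<noteq> f x \<and> f z \<noteq> f y" if "z \<in> pverts G" "z \<notin> A" for z
      using blockD(1)[of G f A x z] blockD(1)[of G f A y z] blocks[of A] xy(1,2) that by blast
    have gD: "g z = f z" if "z \<in> pverts G - A" for z
      using sep that by (auto simp: g_def)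
    have disjAD: "B \<subseteq> pverts G - A" if "B \<in> D" for B
    proof -
      have "B \<noteq> A" using that assms(2) by blast
      moreover have "disjoint (insert A D)" "\<Union>(insert A D) = pverts G"
        using part by (simp_all add: partition_on_def)
      ultimately show ?thesis using that disjointD[of "insert A D" B A] by (simp add: subset_iff) blast
    qed
    have blA: "block G g A"
      unfolding block_def
    proof (intro ballI impI)
      fix z w assume z: "z \<in> A" and w: "w \<in> pverts G" and "g z = g w"
      then consider "f z = f w" | "f z \<in> {f x, f y}" "f w \<in> {f x, f y}"
        unfolding g_def by (metis insertCI)
      then show "w \<in> A \<and> outside_nbhd G A z = outside_nbhd G A w"
      proof cases
        case 1
        then show ?thesis using blockD[of G f A z w] blocks[of A] z w by simp
      next
        case 2
        have "u \<in> A \<and> outside_nbhd G A u = outside_nbhd G A x"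
          if "u \<in> pverts G" "f u \<in> {f x, f y}" for u
          using blockD[of G f A x u] blockD[of G f A y u] blocks[of A] xy that by auto
        then show ?thesis using 2 z w AV by (simp add: subset_iff)
      qed
    qed
    have gA: "g ` A = f ` A - {f y}"
      using xy by (force simp: g_def)
    have cgA: "card (g ` A) < card (f ` A)"
      unfolding gA using xy finA by (intro card_Diff1_less) auto
    have sys: "block_system G m g (insert A D)"
      unfolding block_system_def
    proof (intro conjI ballI part)
      fix B assume B: "B \<in> insert A D"
      show "block G g B"
      proof (cases "B = A")
        case False
        then have BD: "B \<in> D" using B by simp
        show ?thesis
          unfolding block_def
        proof (intro ballI impI)
          fix z w assume z: "z \<in> B" and w: "w \<in> pverts G" and zw: "g z = g w"
          have zV: "z \<in> pverts G - A" using z disjAD BD by auto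
          \<comment> \<open>If \<open>w\<close> were in \<open>A\<close>, the block property of
            \<open>A\<close> under \<open>g\<close> would pull \<open>z\<close> into
            \<open>A\<close>.\<close>
          then have "w \<notin> A" using blockD(1)[OF blA, of w z] zw zV by auto
          then have "f z = f w" using gD zV w zw by simp
          then show "w \<in> B \<and> outside_nbhd G B z = outside_nbhd G B w"
            using blockD[of G f B z w] blocks[OF B] z w by simp
        qed
      qed (simp add: blA)
      show "card (g ` B) \<le> m"
      proof (cases "B = A")
        case True
        then show ?thesis using cgA blocks[of A] by simp
      next
        case False
        then have "g ` B = f ` B" using gD disjAD B by (intro image_cong) auto
        then show ?thesis using blocks[OF B] by simp
      qed
    qed
    have "contract (f x) (f y) (f x) (quotient_trigraph G f) = quotient_trigraph G g"
      unfolding g_def using V xy by (intro contract_quotient) auto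
    then have "contraction (quotient_trigraph G f) (quotient_trigraph G g)"
      unfolding contraction_def using V xy(3) by (metis DiffD2 imageI insertI1 tverts_quotient)
    then have step: "bounded_contraction (m - 1) (quotient_trigraph G f) (quotient_trigraph G g)"
      unfolding bounded_contraction_def using max_red_degree_block_system[OF sys] V by auto
    from less.hyps[OF cgA sys] obtain h where h:
      "(bounded_contraction (m - 1))\<^sup>*\<^sup>* (quotient_trigraph G g) (quotient_trigraph G h)"
      "block_system G m h (insert A D)" "\<forall>x\<in>\<Union>D. h x = g x"
      "card (h ` A) \<le> card (outside_nbhd G A ` A)"
      by blast
    have "\<forall>z\<in>\<Union>D. h z = f z" using h(3) gD disjAD by fastforce
    then show ?thesis
      using h step by (meson converse_rtranclp_into_rtranclp)
  qed
qed

text \<open>Vertices that agree outside \<open>A\<close>, or outside \<open>B\<close>, also agree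
  outside the larger set \<open>A \<union> B\<close>; the price is that the part counts add up. The
  second conclusion is what \<open>contract_block\<close> requires of the new block.\<close>

lemma block_system_join:
  assumes "block_system G m f (insert A (insert B D))" and "A \<noteq> B" "A \<notin> D" "B \<notin> D"
    and "card (f ` A) + card (f ` B) \<le> m"
  shows "block_system G m f (insert (A \<union> B) D)" and "A \<union> B \<notin> D"
proof -
  have part: "partition_on (pverts G) (insert A (insert B D))"
    and blocks: "\<And>C. C \<in> insert A (insert B D) \<Longrightarrow> block G f C \<and> card (f ` C) \<le> m"
    using assms(1) unfolding block_system_def by auto
  have disj: "disjoint (insert A (insert B D))"
    using part by (simp add: partition_on_def)
  have dj: "A \<inter> C = {}" "B \<inter> C = {}" if C: "C \<in> D" for C
  proof -
    have "A \<noteq> C" "B \<noteq> C" using C assms(3,4) by auto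
    then show "A \<inter> C = {}" "B \<inter> C = {}"
      using disjointD[OF disj, of A C] disjointD[OF disj, of B C] C by simp_all
  qed
  have ne: "A \<noteq> {}" using part by (auto simp: partition_on_def)
  show "A \<union> B \<notin> D" using dj(1)[of "A \<union> B"] ne by blast
  have disjD: "X \<inter> Y = {}" if "X \<in> D" "Y \<in> D" "X \<noteq> Y" for X Y
    using disjointD[OF disj, of X Y] that by simp
  have "disjoint (insert (A \<union> B) D)"
  proof (rule disjointI)
    fix X Y assume "X \<in> insert (A \<union> B) D" "Y \<in> insert (A \<union> B) D" "X \<noteq> Y"
    then consider "X = A \<union> B" "Y \<in> D" | "Y = A \<union> B" "X \<in> D" | "X \<in> D" "Y \<in> D" by blast
    then show "X \<inter> Y = {}"
    proof cases
      case 1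
      then show ?thesis using dj[of Y] by (simp add: Int_Un_distrib2)
    next
      case 2
      then show ?thesis using dj[of X] by (simp add: Int_Un_distrib Int_commute)
    next
      case 3
      then show ?thesis using disjD \<open>X \<noteq> Y\<close> by simp
    qed
  qed
  then have "partition_on (pverts G) (insert (A \<union> B) D)"
    using part ne by (simp add: partition_on_def Un_assoc)
  moreover have "block G f (A \<union> B)"
    unfolding block_def
  proof (intro ballI impI)
    fix x y assume x: "x \<in> A \<union> B" and y: "y \<in> pverts G" and xy: "f x = f y"
    have out: "outside_nbhd G (A \<union> B) z = outside_nbhd G A z - B"
         "outside_nbhd G (A \<union> B) z = outside_nbhd G B z - A" for z
      by (auto simp: outside_nbhd_def)
    from x show "y \<in> A \<union> B \<and> outside_nbhd G (A \<union> B) x = outside_nbhd G (A \<union> B) y"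
    proof
      assume "x \<in> A"
      then show ?thesis using blockD[of G f A x y] blocks[of A] y xy by (simp add: out(1))
    next
      assume "x \<in> B"
      then show ?thesis using blockD[of G f B x y] blocks[of B] y xy by (simp add: out(2))
    qed
  qed
  moreover have "card (f ` (A \<union> B)) \<le> m"
    using assms(5) card_Un_le[of "f ` A" "f ` B"] by (simp add: image_Un)
  ultimately show "block_system G m f (insert (A \<union> B) D)"
    using blocks unfolding block_system_def by simp
qed

text \<open>\<open>D\<close> holds the blocks away from the subtree, so that the induction can work
  on one child while the other waits in \<open>D\<close>. The factor 2 is for the moment when two
  children with at most \<open>K\<close> parts each have been joined and their common block is not
  yet contracted.\<close>

lemma (in pair_graph) contract_subtree:
  assumes "distinct (leaves t)"
    and "\<forall>B\<in>insert (set (leaves t)) (lower_sides t). card (outside_nbhd G B ` B) \<le> K"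
    and "block_system G (2 * K) f (D \<union> (\<lambda>x. {x}) ` set (leaves t))"
    and "\<Union>D \<inter> set (leaves t) = {}"
  shows "\<exists>g. (bounded_contraction (2 * K - 1))\<^sup>*\<^sup>* (quotient_trigraph G f) (quotient_trigraph G g) \<and>
    block_system G (2 * K) g (insert (set (leaves t)) D) \<and> (\<forall>x\<in>\<Union>D. g x = f x) \<and>
    card (g ` set (leaves t)) \<le> card (outside_nbhd G (set (leaves t)) ` set (leaves t))"
  using assms
proof (induction t arbitrary: f D)
  case (DLeaf v)
  then show ?case by (intro exI[of _ f]) simp
next
  case (DNode l r)
  let ?A = "set (leaves l)" and ?B = "set (leaves r)"
  let ?Q = "quotient_trigraph G"
  have ne: "set (leaves t) \<noteq> {}" for t :: "'a dtree"
    by (induction t) auto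
  have AB: "?A \<inter> ?B = {}" using DNode.prems(1) by simp
  have D: "\<Union>D \<inter> ?A = {}" "\<Union>D \<inter> ?B = {}" using DNode.prems(4) by auto
  \<comment> \<open>While the left subtree is processed, the right leaves wait as singleton
    blocks.\<close>
  let ?DA = "D \<union> (\<lambda>x. {x}) ` ?B"
  have "block_system G (2 * K) f (?DA \<union> (\<lambda>x. {x}) ` ?A)"
    using DNode.prems(3) by (simp add: image_Un Un_ac)
  moreover have "\<Union>?DA \<inter> ?A = {}" using D AB by auto
  ultimately obtain g where g:
    "(bounded_contraction (2 * K - 1))\<^sup>*\<^sup>* (?Q f) (?Q g)"
    "block_system G (2 * K) g (insert ?A ?DA)" "\<forall>x\<in>\<Union>?DA. g x = f x"
    "card (g ` ?A) \<le> card (outside_nbhd G ?A ` ?A)"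
    using DNode.IH(1)[of f ?DA] DNode.prems(1,2) by auto
  \<comment> \<open>Now the finished left side is one of the blocks to be left alone.\<close>
  let ?DB = "insert ?A D"
  have "block_system G (2 * K) g (?DB \<union> (\<lambda>x. {x}) ` ?B)"
    using g(2) by simp
  moreover have "\<Union>?DB \<inter> ?B = {}" using D AB by auto
  ultimately obtain h where h:
    "(bounded_contraction (2 * K - 1))\<^sup>*\<^sup>* (?Q g) (?Q h)"
    "block_system G (2 * K) h (insert ?B ?DB)" "\<forall>x\<in>\<Union>?DB. h x = g x"
    "card (h ` ?B) \<le> card (outside_nbhd G ?B ` ?B)"
    using DNode.IH(2)[of g ?DB] DNode.prems(1,2) by auto
  \<comment> \<open>The right-hand pass keeps all values on the left block, so the bound on its
    parts survives.\<close>
  have "h ` ?A = g ` ?A" using h(3) by (intro image_cong) auto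
  then have "card (h ` ?A) \<le> K"
    using g(4) DNode.prems(2) by auto
  moreover have "card (h ` ?B) \<le> K"
    using h(4) DNode.prems(2) by auto
  ultimately have cards: "card (h ` ?A) + card (h ` ?B) \<le> 2 * K" by simp
  \<comment> \<open>Disjointness makes these sets distinct only because leaf sets are
    nonempty.\<close>
  have notin: "?A \<noteq> ?B" "?A \<notin> D" "?B \<notin> D"
    using AB D ne[of l] ne[of r] Union_upper[of ?A D] Union_upper[of ?B D]
    by (simp_all add: disjoint_iff subset_iff) (metis all_not_in_conv set_empty)+
  have sys: "block_system G (2 * K) h (insert (?A \<union> ?B) D)" and nin: "?A \<union> ?B \<notin> D"
    using block_system_join[of G "2 * K" h ?A ?B D] h(2) notin cards by (simp_all add: insert_commute)
  from contract_block[OF sys nin] obtain e where e: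
    "(bounded_contraction (2 * K - 1))\<^sup>*\<^sup>* (?Q h) (?Q e)"
    "block_system G (2 * K) e (insert (?A \<union> ?B) D)" "\<forall>x\<in>\<Union>D. e x = h x"
    "card (e ` (?A \<union> ?B)) \<le> card (outside_nbhd G (?A \<union> ?B) ` (?A \<union> ?B))"
    by blast
  have "(bounded_contraction (2 * K - 1))\<^sup>*\<^sup>* (?Q f) (?Q e)"
    using g(1) h(1) e(1) by (meson rtranclp_trans)
  moreover have "\<forall>x\<in>\<Union>D. e x = f x" using e(3) h(3) g(3) by auto
  ultimately show ?case using e by auto
qed

section \<open>From contractions to twin-width\<close>

text \<open>The condition on \<open>w\<close> excludes the kept vertices, so two vertices give way
  to exactly one, even if \<open>w\<close> reuses \<open>u\<close> or \<open>v\<close>.\<close>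

lemma card_contraction:
  assumes "contraction H H'" "finite (tverts H)"
  shows "finite (tverts H')" "card (tverts H) = Suc (card (tverts H'))"
proof -
  obtain u v w where uv: "u \<in> tverts H" "v \<in> tverts H" "u \<noteq> v" "w \<notin> tverts H - {u, v}"
    "tverts H' = insert w (tverts H - {u, v})"
    using assms(1) unfolding contraction_def contract_def Let_def by force
  show "finite (tverts H')" using uv assms(2) by simp
  have "card (tverts H) = card (insert u (insert v (tverts H - {u, v})))"
    using uv by (intro arg_cong[where f = card]) auto
  also have "\<dots> = Suc (Suc (card (tverts H - {u, v})))"
    using uv assms(2) by simp
  also have "Suc (card (tverts H - {u, v})) = card (tverts H')"
    using uv(4,5) assms(2) by simp
  finally show "card (tverts H) = Suc (card (tverts H'))" .
qed

text \<open>Every step removes one vertex, so a chain ending in a single vertex automatically has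
  the right length. \<open>bounded_contraction\<close> bounds only the target, hence the separate
  premise on the starting trigraph.\<close>

lemma twin_width_le:
  assumes steps: "(bounded_contraction d)\<^sup>*\<^sup>* (trigraph_of G) H'"
    and "finite (pverts G)" and "max_red_degree (trigraph_of G) \<le> d" and "card (tverts H') = 1"
  shows "twin_width G \<le> d"
proof -
  let ?n = "card (pverts G)"
  obtain m where "(bounded_contraction d ^^ m) (trigraph_of G) H'"
    using steps rtranclp_power by metis
  then obtain F where F: "F 0 = trigraph_of G" "F m = H'"
    "\<And>i. i < m \<Longrightarrow> bounded_contraction d (F i) (F (Suc i))"
    unfolding relpowp_fun_conv by blast
  have card: "finite (tverts (F i)) \<and> card (tverts (F i)) + i = ?n" if "i \<le> m" for i
    using that
  proof (induction i)
    case 0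
    then show ?case using F(1) assms(2) by (simp add: trigraph_of_def)
  next
    case (Suc i)
    then have "contraction (F i) (F (Suc i))" using F(3) unfolding bounded_contraction_def by simp
    then show ?case using card_contraction Suc by fastforce
  qed
  have deg: "max_red_degree (F i) \<le> d" if "i \<le> m" for i
    using that F(1,3) assms(3) by (cases i) (auto simp: bounded_contraction_def)
  have n: "?n = Suc m" using card[of m] F(2) assms(4) by simp
  \<comment> \<open>\<open>F\<close> is indexed by the steps taken, a contraction sequence by the
    vertices left.\<close>
  define H where "H = (\<lambda>i. F (?n - i))"
  have "contraction_sequence G H"
    unfolding contraction_sequence_def
  proof (intro conjI ballI)
    show "H ?n = trigraph_of G" by (simp add: H_def F)
    show "card (tverts (H 1)) = 1" using n F(2) assms(4) by (simp add: H_def)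
    fix i assume i: "i \<in> {1..<?n}"
    then have "?n - i = Suc (?n - Suc i)" "?n - Suc i < m" using n by auto
    then show "contraction (H (Suc i)) (H i)"
      using F(3)[of "?n - Suc i"] unfolding H_def bounded_contraction_def by simp
  qed
  moreover have "\<forall>i\<in>{1..?n}. max_red_degree (H i) \<le> d"
    using deg n by (auto simp: H_def)
  ultimately show ?thesis
    unfolding twin_width_def by (intro Least_le) blast
qed

lemma (in pair_graph) twin_width_le_if_tree:
  assumes T: "decomposition_tree G T" and "K \<ge> 1"
    and K: "\<forall>B\<in>lower_sides T. card (outside_nbhd G B ` B) \<le> K"
  shows "twin_width G \<le> 2 * K - 1"
proof -
  let ?V = "pverts G"
  have leaves: "distinct (leaves T)" "set (leaves T) = ?V"
    using T unfolding decomposition_tree_def by auto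
  have ne: "?V \<noteq> {}"
  proof -
    have "leaves T \<noteq> []" by (induction T) auto
    then show ?thesis using leaves(2) by auto
  qed
  \<comment> \<open>No tree edge cuts off the whole vertex set, so \<open>K\<close> says nothing
    about it. As nothing lies outside, there is one class, and the last contractions reach a single
    vertex.\<close>
  have root: "card (outside_nbhd G ?V ` ?V) = 1"
  proof -
    have "outside_nbhd G ?V ` ?V = {{}}" using ne by (auto simp: outside_nbhd_def)
    then show ?thesis by simp
  qed
  let ?S = "(\<lambda>x. {x}) ` ?V"
  have sys: "block_system G (2 * K) id ?S"
    using \<open>K \<ge> 1\<close> unfolding block_system_def partition_on_def block_def disjoint_def by auto
  obtain g where g: "(bounded_contraction (2 * K - 1))\<^sup>*\<^sup>* (trigraph_of G) (quotient_trigraph G g)"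
    "card (g ` ?V) \<le> 1"
    using contract_subtree[of T K id "{}"] leaves sys K root \<open>K \<ge> 1\<close>
    by (auto simp: quotient_trigraph_id)
  have "card (g ` ?V) = 1"
    using g(2) ne finite_verts card_gt_0_iff[of "g ` ?V"] by simp
  \<comment> \<open>The initial singleton blocks also bound the red degree of the starting
    trigraph.\<close>
  then show ?thesis
    using max_red_degree_block_system[OF sys ne]
    by (intro twin_width_le[OF g(1) finite_verts]) (simp_all add: quotient_trigraph_id)
qed

section \<open>Optimal decomposition trees\<close>

lemma lower_sides_subset: "B \<in> lower_sides T \<Longrightarrow> B \<subseteq> set (leaves T)"
  by (induction T) auto

lemma finite_lower_sides: "finite (lower_sides T)"
  by (induction T) auto

text \<open>A caterpillar will do: leaves are attached one at a time.\<close>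

lemma exists_decomposition_tree:
  assumes "finite (pverts G)" "pverts G \<noteq> {}"
  shows "\<exists>T. decomposition_tree G T"
proof -
  have "\<exists>T. distinct (leaves T) \<and> set (leaves T) = V" if "finite V" "V \<noteq> {}" for V :: "'a set"
    using that
  proof (induction V rule: finite_ne_induct)
    case (singleton x)
    then show ?case by (intro exI[of _ "DLeaf x"]) simp
  next
    case (insert x V)
    then obtain T where "distinct (leaves T)" "set (leaves T) = V" by blast
    then show ?case using insert by (intro exI[of _ "DNode (DLeaf x) T"]) simp
  qed
  then show ?thesis using assms unfolding decomposition_tree_def by blast
qed

text \<open>\<open>Min\<close> is sure to yield a member only for a finite nonempty set, so both
  properties are secured before an optimal tree is picked.\<close>

lemma boolean_width_attained:
  assumes fin: "finite (pverts G)" and ne: "pverts G \<noteq> {}"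
  obtains T where "decomposition_tree G T" "boolean_width G = tree_boolean_width G T"
proof -
  let ?W = "{tree_boolean_width G T |T. decomposition_tree G T}"
  let ?cut = "\<lambda>A. cut_boolean_width G A (pverts G - A)"
  \<comment> \<open>Each width is the maximum of a set of widths of cuts, so no bound on the number of trees is
    needed.\<close>
  have "?W \<subseteq> Max ` insert 0 ` Pow (?cut ` Pow (pverts G))"
  proof
    fix w assume "w \<in> ?W"
    then obtain T where T: "decomposition_tree G T" "w = tree_boolean_width G T" by blast
    have "{?cut A |A. A \<in> lower_sides T} \<subseteq> ?cut ` Pow (pverts G)"
      using T(1) lower_sides_subset unfolding decomposition_tree_def by fastforce
    then show "w \<in> Max ` insert 0 ` Pow (?cut ` Pow (pverts G))"
      unfolding T(2) tree_boolean_width_def by (intro imageI) simp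
  qed
  then have "finite ?W" using fin by (meson finite_Pow_iff finite_imageI finite_subset)
  moreover have "?W \<noteq> {}" using exists_decomposition_tree[OF fin ne] by blast
  ultimately have "Min ?W \<in> ?W" by (rule Min_in)
  then show ?thesis using that unfolding boolean_width_def by blast
qed

lemma tree_boolean_width_nonneg: "tree_boolean_width G T \<ge> 0"
  unfolding tree_boolean_width_def using finite_lower_sides[of T] by (intro Max_ge) auto

text \<open>Singletons \<open>S\<close> already produce all outside neighbourhoods, so the cut
  counts at least as many sets.\<close>

lemma card_outside_nbhd_le:
  assumes fin: "finite (pverts G)" and "B \<in> lower_sides T"
  shows "real (card (outside_nbhd G B ` B)) \<le> 2 powr tree_boolean_width G T"
proof -
  let ?C = "{nbhd G S \<inter> (pverts G - B) |S. S \<subseteq> B}"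
  have "?C \<subseteq> Pow (pverts G)" by auto
  then have finC: "finite ?C" using fin by (meson finite_Pow_iff finite_subset)
  have "outside_nbhd G B ` B \<subseteq> ?C" unfolding outside_nbhd_def by blast
  then have "card (outside_nbhd G B ` B) \<le> card ?C" using finC by (rule card_mono[rotated])
  moreover have "card ?C > 0" using finC by (auto simp: card_gt_0_iff)
  then have "real (card ?C) = 2 powr cut_boolean_width G B (pverts G - B)"
    unfolding cut_boolean_width_def by simp
  moreover have "cut_boolean_width G B (pverts G - B) \<le> tree_boolean_width G T"
    unfolding tree_boolean_width_def using finite_lower_sides[of T] assms(2)
    by (intro Max_ge) auto
  then have "2 powr cut_boolean_width G B (pverts G - B) \<le> 2 powr tree_boolean_width G T"
    by simp
  ultimately show ?thesis by linarith
qed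

theorem theorem4p2:
  fixes G :: "'a pair_pre_digraph" and k :: real
  assumes "pair_graph G"
    and "pverts G \<noteq> {}"
    and "boolean_width G = k"
  shows "real (twin_width G) \<le> 2 powr (k + 1) - 1"
proof -
  interpret pair_graph G by fact
  obtain T where T: "decomposition_tree G T" "k = tree_boolean_width G T"
    using boolean_width_attained[OF finite_verts assms(2)] assms(3) by metis
  \<comment> \<open>The number of classes needs a natural bound; a cardinality at most
    \<open>2 powr k\<close> is at most its floor, so rounding loses nothing.\<close>
  define K where "K = nat \<lfloor>2 powr k\<rfloor>"
  have "2 powr k \<ge> 1"
    using tree_boolean_width_nonneg[of G T] T(2) by (simp add: ge_one_powr_ge_zero)
  then have K: "K \<ge> 1" "real K \<le> 2 powr k"
    unfolding K_def by linarith+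
  have "card (outside_nbhd G B ` B) \<le> K" if "B \<in> lower_sides T" for B
    using card_outside_nbhd_le[OF finite_verts that] T(2) unfolding K_def by (simp add: le_nat_floor)
  then have "twin_width G \<le> 2 * K - 1"
    using twin_width_le_if_tree[OF T(1) K(1)] by blast
  \<comment> \<open>\<open>K \<ge> 1\<close> keeps the natural subtraction in
    \<open>2 * K - 1\<close> from truncating.\<close>
  then have "real (twin_width G) \<le> 2 * real K - 1" using K(1) by linarith
  also have "\<dots> \<le> 2 powr (k + 1) - 1" using K(2) by (simp add: powr_add)
  finally show ?thesis .
qed

end
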